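(* Let $\mathcal{V}$ be a primitive subspace of $\mathcal{J}_3(\mathbb{F}_2)$ with dimension $4$. Then $\mathcal{V}$ is equivalent to one and only one of the four spaces associated with the generic matrices $$\mathbf{N}_1:=\begin{bmatrix}\mathbf{a}&\mathbf{c}&0\\0&\mathbf{a}+\mathbf{b}&\mathbf{d}\\0&0&\mathbf{b}\end{bmatrix},\quad \mathbf{N}_2:=\begin{bmatrix}\mathbf{a}&\mathbf{c}&\mathbf{d}\\0&\mathbf{a}+\mathbf{b}&0\\0&0&\mathbf{b}\end{bmatrix},\quad \mathbf{N}_3:=\begin{bmatrix}\mathbf{a}&0&\mathbf{c}\\0&\mathbf{a}+\mathbf{b}&\mathbf{d}\\0&0&\mathbf{b}\end{bmatrix},\quad \mathbf{N}_4:=\begin{bmatrix}\mathbf{a}&\mathbf{c}&\mathbf{d}\\0&\mathbf{a}+\mathbf{b}&\mathbf{c}\\0&0&\mathbf{b}\end{bmatrix}.$$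
   Context: $\mathrm{M}_{n,p}(\mathbb{K})$ is the space of $n\times p$ matrices over a field $\mathbb{K}$, and $\mathrm{M}_n(\mathbb{K})=\mathrm{M}_{n,n}(\mathbb{K})$. The upper rank $\operatorname{urk}(\mathcal{V})$ of a linear subspace $\mathcal{V}$ of $\mathrm{M}_{n,p}(\mathbb{K})$ is the maximal rank of a matrix in $\mathcal{V}$. Two linear subspaces $\mathcal{V}_1,\mathcal{V}_2$ of $\mathrm{M}_{n,p}(\mathbb{K})$ are equivalent when $\mathcal{V}_2=P\mathcal{V}_1Q$ for some $P\in\mathrm{GL}_n(\mathbb{K})$, $Q\in\mathrm{GL}_p(\mathbb{K})$. A linear subspace $\mathcal{V}$ of $\mathrm{M}_{n,p}(\mathbb{K})$ with upper rank $r$ is called primitive when: (i) no non-zero vector of $\mathbb{K}^p$ belongs to the kernel of every matrix of $\mathcal{V}$; (ii) the span of the ranges of all the matrices of $\mathcal{V}$ is $\mathbb{K}^n$; (iii) $\mathcal{V}$ is not equivalent to a space $\mathcal{T}$ of matrices of the form $M=\begin{bmatrix} H(M) & [?]_{n\times 1}\end{bmatrix}$ (so $H(M)\in\mathrm{M}_{n,p-1}(\mathbb{K})$) where $\operatorname{urk}H(\mathcal{T})\leq r-1$; (iv) $\mathcal{V}$ is not equivalent to a space $\mathcal{T}$ of matrices of the form $M=\begin{bmatrix} H(M)\\ [?]_{1\times p}\end{bmatrix}$ (so $H(M)\in\mathrm{M}_{n-1,p}(\mathbb{K})$) where $\operatorname{urk}H(\mathcal{T})\leq r-1$. $\mathcal{J}_3(\mathbb{F}_2)$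 is the space of all upper-triangular $3\times 3$ matrices over $\mathbb{F}_2$ with trace zero. The space associated with a generic matrix in the independent indeterminates $\mathbf{a},\mathbf{b},\mathbf{c},\mathbf{d}$ is the linear subspace of $\mathrm{M}_3(\mathbb{F}_2)$ consisting of all matrices obtained by substituting arbitrary elements of $\mathbb{F}_2$ for the indeterminates. *)

theory Defs
  imports
    "HOL-Library.Z2"
    "Jordan_Normal_Form.DL_Rank"
    "Jordan_Normal_Form.Matrix_Kernel"
begin

text \<open>Dimensions are explicit (\<open>carrier_mat n p\<close>), and a linear subspace of the \<open>n \<times> p\<close> matrices
  is a set of matrices. The field with two elements is the type \<open>bit\<close>.\<close>

abbreviation mat_subspace :: "nat \<Rightarrow> nat \<Rightarrow> 'a::field mat set \<Rightarrow> bool" where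
  "mat_subspace n p V \<equiv> subspace class_ring V (module_mat TYPE('a) n p)"

abbreviation mat_subspace_dim :: "nat \<Rightarrow> nat \<Rightarrow> 'a::field mat set \<Rightarrow> nat" where
  "mat_subspace_dim n p V \<equiv> vectorspace.dim class_ring ((module_mat TYPE('a) n p)\<lparr>carrier := V\<rparr>)"

text \<open>\<open>n\<close> is the number of rows; the ranks are bounded by \<open>n\<close>, so for nonempty \<open>V\<close> the maximum is
  taken over a finite nonempty set even when the field is infinite.\<close>

definition upper_rank :: "nat \<Rightarrow> 'a::field mat set \<Rightarrow> nat" where
  "upper_rank n V = Max (vec_space.rank n ` V)"

definition mat_equivalent :: "nat \<Rightarrow> nat \<Rightarrow> 'a::field mat set \<Rightarrow> 'a mat set \<Rightarrow> bool" where
  "mat_equivalent n p V1 V2 \<longleftrightarrow>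
     (\<exists>P \<in> carrier_mat n n. \<exists>Q \<in> carrier_mat p p.
        invertible_mat P \<and> invertible_mat Q \<and> V2 = (\<lambda>M. P * M * Q) ` V1)"

definition append_cols :: "'a::zero mat \<Rightarrow> 'a mat \<Rightarrow> 'a mat" (infixr \<open>@\<^sub>c\<close> 65) where
  "A @\<^sub>c B = four_block_mat A B (0\<^sub>m 0 (dim_col A)) (0\<^sub>m 0 (dim_col B))"

text \<open>In the last two conditions \<open>H\<close> picks the block \<open>H(M)\<close>; the ranks are compared in the integers,
  so that \<open>r - 1\<close> is \<open>-1\<close> when \<open>r = 0\<close>. When \<open>p = 0\<close> (respectively \<open>n = 0\<close>), no
  matrix has the required block form.\<close>

definition primitive_space :: "nat \<Rightarrow> nat \<Rightarrow> 'a::field mat set \<Rightarrow> bool" where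
  "primitive_space n p V \<longleftrightarrow>
     mat_subspace n p V \<and>
     (\<forall>x \<in> carrier_vec p. (\<forall>M \<in> V. x \<in> mat_kernel M) \<longrightarrow> x = 0\<^sub>v p) \<and>
     LinearCombinations.module.span class_ring (module_vec TYPE('a) n)
       (\<Union>M \<in> V. {M *\<^sub>v x | x. x \<in> carrier_vec p}) = carrier_vec n \<and>
     \<not> (\<exists>T H. mat_equivalent n p V T \<and>
          (\<forall>M \<in> T. H M \<in> carrier_mat n (p - 1) \<and> (\<exists>C \<in> carrier_mat n 1. M = H M @\<^sub>c C)) \<and>
          int (upper_rank n (H ` T)) \<le> int (upper_rank n V) - 1) \<and>
     \<not> (\<exists>T H. mat_equivalent n p V T \<and>
          (\<forall>M \<in> T. H M \<in> carrier_mat (n - 1) p \<and> (\<exists>R \<in> carrier_mat 1 p. M = H M @\<^sub>r R)) \<and>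
          int (upper_rank (n - 1) (H ` T)) \<le> int (upper_rank n V) - 1)"

definition mat_trace :: "'a::comm_monoid_add mat \<Rightarrow> 'a" where
  "mat_trace A = (\<Sum>i<dim_row A. A $$ (i, i))"

definition J3 :: "bit mat set" where
  "J3 = {A \<in> carrier_mat 3 3. upper_triangular A \<and> mat_trace A = 0}"

definition N1 :: "bit mat set" where
  "N1 = {mat_of_rows_list 3 [[a, c, 0],
                             [0, a + b, d],
                             [0, 0, b]] | a b c d. True}"

definition N2 :: "bit mat set" where
  "N2 = {mat_of_rows_list 3 [[a, c, d],
                             [0, a + b, 0],
                             [0, 0, b]] | a b c d. True}"

definition N3 :: "bit mat set" where
  "N3 = {mat_of_rows_list 3 [[a, 0, c],
                             [0, a + b, d],
                             [0, 0, b]] | a b c d. True}"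

definition N4 :: "bit mat set" where
  "N4 = {mat_of_rows_list 3 [[a, c, d],
                             [0, a + b, c],
                             [0, 0, b]] | a b c d. True}"

end

theory Submission
  imports Defs
begin

text \<open>The space \<^const>\<open>J3\<close> has dimension 5, with coordinates the diagonal entries \<open>a\<close> and \<open>b\<close> at the
  two ends and the three entries \<open>u, v, w\<close> above the diagonal, where \<open>v\<close> is the corner. A subspace of
  dimension 4 is therefore the zero set of a non-zero linear form \<open>\<alpha> a + \<beta> b + \<gamma> u + \<delta> v + \<epsilon> w\<close>
  (\<open>dim_4_subspace_is_J3_hyperplane\<close>), and the four model spaces are the zero sets of \<open>v\<close>, \<open>w\<close>, \<open>u\<close>
  and \<open>u + w\<close>.

  A form in \<open>a\<close> and \<open>b\<close> alone never gives a primitive space: the zero sets of \<open>a\<close> and \<open>b\<close> consist of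
  matrices with zero first column and with zero last row, and deleting the last column from the
  matrices in the zero set of \<open>a + b\<close> lowers the upper rank from 2 to 1 (\<open>not_primitive_diagonal_form\<close>).

  Every other form can be simplified by multiplying \<^const>\<open>J3\<close> on both sides by upper unitriangular
  matrices. These products change \<open>u\<close> and \<open>w\<close> by multiples of diagonal entries, and \<open>v\<close> by
  combinations of all the other entries, which is enough to reach one of the four models
  (\<open>J3_hyperplane_equivalent_N\<close>).

  The models are pairwise inequivalent because the sum over all vectors \<open>x\<close> of the number of elements
  of \<open>{M x | M \<in> V}\<close> is invariant under equivalence (\<open>evaluation_total_equivalent\<close>) and takes the
  values 39, 35, 41 and 43 on them (\<open>evaluation_total_N\<close>).\<close>

section \<open>Explicit matrices of size three\<close>

lemma UNIV_bit: "(UNIV :: bit set) = {0, 1}"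
  using bit.exhaust by blast

lemma bit_add_self: "(x::bit) + x = 0" by (cases x) simp_all

lemma mat_bit_add_self_left:
  assumes "A \<in> carrier_mat n p" "B \<in> carrier_mat n p"
  shows "A + (A + B) = (B :: bit mat)"
  by (rule eq_matI) (use assms in auto)

lemma less_3_cases: "i < 3 \<longleftrightarrow> i = 0 \<or> i = 1 \<or> i = (2::nat)"
  by auto

lemma mat_of_rows_list_3_eqI:
  fixes A :: "'a mat"
  assumes "A \<in> carrier_mat 3 3"
    and "A $$ (0,0) = a" "A $$ (0,1) = b" "A $$ (0,2) = c"
    and "A $$ (1,0) = d" "A $$ (1,1) = e" "A $$ (1,2) = f"
    and "A $$ (2,0) = g" "A $$ (2,1) = h" "A $$ (2,2) = i"
  shows "A = mat_of_rows_list 3 [[a, b, c], [d, e, f], [g, h, i]]"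
  by (rule eq_matI)
    (use assms in \<open>auto simp: mat_of_rows_list_def numeral_3_eq_3 numeral_2_eq_2 less_Suc_eq\<close>)

lemma mat_of_rows_list_3_carrier [simp]: "mat_of_rows_list 3 [r, s, t] \<in> carrier_mat 3 3"
  by (rule carrier_matI) (simp_all add: mat_of_rows_list_def)

lemma sum_upt_3: "sum f {0..<3} = f 0 + f 1 + f (2::nat)" for f :: "nat \<Rightarrow> 'a::comm_monoid_add"
  by (simp add: numeral_3_eq_3 numeral_2_eq_2)

lemma mult_mat_of_rows_list_3:
  fixes a :: "'a::semiring_0"
  shows "mat_of_rows_list 3 [[a, b, c], [d, e, f], [g, h, i]] *
    mat_of_rows_list 3 [[a', b', c'], [d', e', f'], [g', h', i']] =
    mat_of_rows_list 3
     [[a * a' + b * d' + c * g', a * b' + b * e' + c * h', a * c' + b * f' + c * i'],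
      [d * a' + e * d' + f * g', d * b' + e * e' + f * h', d * c' + e * f' + f * i'],
      [g * a' + h * d' + i * g', g * b' + h * e' + i * h', g * c' + h * f' + i * i']]"
  by (rule mat_of_rows_list_3_eqI,
      rule mult_carrier_mat[OF mat_of_rows_list_3_carrier mat_of_rows_list_3_carrier])
    (simp_all add: mat_of_rows_list_def scalar_prod_def sum_upt_3)

lemma add_mat_of_rows_list_3:
  "mat_of_rows_list 3 [[a, b, c], [d, e, f], [g, h, i]] +
    mat_of_rows_list 3 [[a', b', c'], [d', e', f'], [g', h', i']] =
    mat_of_rows_list 3
     [[a + a', b + b', c + c'], [d + d', e + e', f + f'], [g + g', h + h', i + i']]"
  by (rule mat_of_rows_list_3_eqI, rule add_carrier_mat[OF mat_of_rows_list_3_carrier])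
    (simp_all add: mat_of_rows_list_def)

lemma mult_mat_of_rows_list_3_vec:
  fixes a :: "'a::semiring_0"
  shows "mat_of_rows_list 3 [[a, b, c], [d, e, f], [g, h, i]] *\<^sub>v vec_of_list [x, y, z] =
    vec_of_list [a * x + b * y + c * z, d * x + e * y + f * z, g * x + h * y + i * z]"
  by (rule eq_vecI)
    (auto simp: mat_of_rows_list_def vec_of_list_index scalar_prod_def sum_upt_3 row_def less_Suc_eq numeral_2_eq_2)

lemma carrier_vec_3_eq: "carrier_vec 3 = {vec_of_list [x, y, z] | x y z. True}"
proof (intro equalityI subsetI)
  fix v :: "'a vec" assume v: "v \<in> carrier_vec 3"
  have "v = vec_of_list [v $ 0, v $ 1, v $ 2]"
    by (rule eq_vecI) (use v in \<open>auto simp: vec_of_list_index less_Suc_eq numeral_3_eq_3 numeral_2_eq_2\<close>)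
  then show "v \<in> {vec_of_list [x, y, z] | x y z. True}" by blast
qed (auto intro!: carrier_vecI)

section \<open>Coordinates on J3\<close>

text \<open>The trace of an upper-triangular matrix with diagonal \<open>a, x, b\<close> vanishes exactly when
  \<open>x = a + b\<close>, so five free entries parametrise \<^const>\<open>J3\<close>.\<close>
definition upper3 :: "bit \<Rightarrow> bit \<Rightarrow> bit \<Rightarrow> bit \<Rightarrow> bit \<Rightarrow> bit mat" where
  "upper3 a b u v w = mat_of_rows_list 3 [[a, u, v], [0, a + b, w], [0, 0, b]]"

lemma J3_eq: "J3 = {upper3 a b u v w | a b u v w. True}"
proof (intro equalityI subsetI)
  fix A assume "A \<in> J3"
  then have A: "A \<in> carrier_mat 3 3" "upper_triangular A" "mat_trace A = 0"
    by (auto simp: J3_def)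
  have diag: "A $$ (1,1) = A $$ (0,0) + A $$ (2,2)"
    using A(1,3) by (cases "A $$ (0,0)"; cases "A $$ (1,1)"; cases "A $$ (2,2)")
      (auto simp: mat_trace_def numeral_3_eq_3 numeral_2_eq_2)
  have "A = upper3 (A $$ (0,0)) (A $$ (2,2)) (A $$ (0,1)) (A $$ (0,2)) (A $$ (1,2))"
    unfolding upper3_def by (rule mat_of_rows_list_3_eqI) (use A diag in auto)
  then show "A \<in> {upper3 a b u v w | a b u v w. True}" by blast
next
  fix A assume "A \<in> {upper3 a b u v w | a b u v w. True}"
  then obtain a b u v w where "A = upper3 a b u v w" by blast
  then show "A \<in> J3"
    by (cases a; cases b) (auto simp: J3_def upper3_def mat_of_rows_list_def upper_triangular_def mat_trace_def numeral_3_eq_3 less_Suc_eq)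
qed

lemma upper3_in_J3 [simp]: "upper3 a b u v w \<in> J3"
  unfolding J3_eq by blast

lemma upper3_add:
  "upper3 a b u v w + upper3 a' b' u' v' w' = upper3 (a + a') (b + b') (u + u') (v + v') (w + w')"
  unfolding upper3_def add_mat_of_rows_list_3 by (simp only: add_ac add_0)

lemma upper3_carrier [simp]: "upper3 a b u v w \<in> carrier_mat 3 3"
  unfolding upper3_def by (rule mat_of_rows_list_3_carrier)

lemma upper3_index:
  "upper3 a b u v w $$ (0, 0) = a" "upper3 a b u v w $$ (0, 1) = u" "upper3 a b u v w $$ (0, 2) = v"
  "upper3 a b u v w $$ (1, 0) = 0" "upper3 a b u v w $$ (1, 1) = a + b" "upper3 a b u v w $$ (1, 2) = w"
  "upper3 a b u v w $$ (2, 0) = 0" "upper3 a b u v w $$ (2, 1) = 0" "upper3 a b u v w $$ (2, 2) = b"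
  by (simp_all add: upper3_def mat_of_rows_list_def)

lemma upper3_inject:
  "upper3 a b u v w = upper3 a' b' u' v' w' \<longleftrightarrow> a = a' \<and> b = b' \<and> u = u' \<and> v = v' \<and> w = w'"
  using upper3_index by metis

lemma card_J3: "finite J3" "card J3 = 32"
proof -
  let ?f = "\<lambda>(a, b, u, v, w). upper3 a b u v w"
  let ?B = "UNIV \<times> UNIV \<times> UNIV \<times> UNIV \<times> UNIV :: (bit \<times> bit \<times> bit \<times> bit \<times> bit) set"
  have eq: "J3 = ?f ` ?B"
  proof (intro equalityI subsetI)
    fix A assume "A \<in> J3"
    then obtain a b u v w where "A = ?f (a, b, u, v, w)" unfolding J3_eq by auto
    then show "A \<in> ?f ` ?B" by blast
  qed auto
  have fin: "finite ?B" "card ?B = 32"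
    by (simp_all add: UNIV_bit card_cartesian_product)
  show "finite J3" unfolding eq using fin by blast
  have "inj_on ?f ?B"
    by (auto simp: inj_on_def upper3_inject)
  from card_image[OF this] show "card J3 = 32" unfolding eq fin(2) .
qed

section \<open>Four-dimensional subspaces are hyperplanes\<close>

text \<open>Coordinates in a basis identify the space with the functions from the basis to the field. Over
  a finite field the dimension hypothesis can thus enter the argument as a count.\<close>
lemma (in vectorspace) card_carrier_eq_power_dim:
  assumes "fin_dim"
  shows "card (carrier V) = card (carrier K) ^ dim"
proof -
  obtain B where B: "finite B" "basis B"
    using finite_basis_exists[OF assms] by blast
  then have sub: "B \<subseteq> carrier V" by (simp add: basis_def)
  have uniq: "\<forall>v. v \<in> carrier V \<longrightarrow> (\<exists>!a. a \<in> B \<rightarrow>\<^sub>E carrier K \<and> lincomb a B = v)"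
    using basis_criterion[OF B(1) sub] B(2) by blast
  have mem: "lincomb a B \<in> carrier V" if "a \<in> B \<rightarrow>\<^sub>E carrier K" for a
    using that sub by (intro lincomb_closed) auto
  have "bij_betw (\<lambda>a. lincomb a B) (B \<rightarrow>\<^sub>E carrier K) (carrier V)"
    unfolding bij_betw_def inj_on_def
  proof (intro conjI ballI impI equalityI subsetI)
    fix a b assume "a \<in> B \<rightarrow>\<^sub>E carrier K" "b \<in> B \<rightarrow>\<^sub>E carrier K" "lincomb a B = lincomb b B"
    then show "a = b" using uniq mem by metis
  next
    fix v assume "v \<in> (\<lambda>a. lincomb a B) ` (B \<rightarrow>\<^sub>E carrier K)"
    then show "v \<in> carrier V" using mem by blast
  next
    fix v assume "v \<in> carrier V"
    then show "v \<in> (\<lambda>a. lincomb a B) ` (B \<rightarrow>\<^sub>E carrier K)" using uniq by blast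
  qed
  then have "card (carrier V) = card (B \<rightarrow>\<^sub>E carrier K)"
    using bij_betw_same_card by metis
  also have "\<dots> = card (carrier K) ^ card B"
    using B(1) by (simp add: card_PiE)
  also have "card B = dim" using dim_basis[OF B] by simp
  finally show ?thesis .
qed

lemma card_mat_subspace:
  fixes V :: "'a::field mat set"
  assumes V: "mat_subspace n p V" and fin: "finite V"
  shows "card V = card (UNIV :: 'a set) ^ mat_subspace_dim n p V"
proof -
  interpret M: vectorspace class_ring "module_mat TYPE('a) n p" by (rule matrix_vs)
  interpret W: vectorspace class_ring "(module_mat TYPE('a) n p)\<lparr>carrier := V\<rparr>"
    by (rule M.subspace_is_vs[OF V])
  have "W.fin_dim" unfolding W.fin_dim_def
    using fin W.in_own_span W.span_is_subset2 by (intro exI[of _ V]) fastforce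
  from W.card_carrier_eq_power_dim[OF this] show ?thesis by simp
qed

lemma mat_subspace_add_closed:
  assumes "mat_subspace n p V" "A \<in> V" "B \<in> V"
  shows "A + B \<in> V"
  using submodule.m_closed[OF subspace.submod[OF assms(1)] assms(2,3)]
  by (simp add: module_mat_simps)

lemma mat_subspace_zero:
  assumes "mat_subspace n p V"
  shows "0\<^sub>m n p \<in> V"
  using submodule.zero_closed[OF subspace.submod[OF assms(1)]]
  by (simp add: module_mat_simps)

text \<open>The zero set of a linear form on \<^const>\<open>J3\<close>, named by the coefficients of the form in the order
  of the arguments of \<^const>\<open>upper3\<close>. It is all of \<^const>\<open>J3\<close> when the form vanishes.\<close>
definition J3_hyperplane :: "bit \<Rightarrow> bit \<Rightarrow> bit \<Rightarrow> bit \<Rightarrow> bit \<Rightarrow> bit mat set" where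
  "J3_hyperplane \<alpha> \<beta> \<gamma> \<delta> \<epsilon> =
     {upper3 a b u v w | a b u v w. \<alpha> * a + \<beta> * b + \<gamma> * u + \<delta> * v + \<epsilon> * w = 0}"

text \<open>A subspace \<open>V\<close> of dimension 4 has 16 of the 32 elements of \<^const>\<open>J3\<close>, so it has index 2 as
  an additive subgroup. The indicator of its complement, with values in the two-element field, is
  therefore additive, hence a linear form with kernel \<open>V\<close>.\<close>
lemma dim_4_subspace_is_J3_hyperplane:
  assumes V: "mat_subspace 3 3 V" and sub: "V \<subseteq> J3" and dim: "mat_subspace_dim 3 3 V = 4"
  obtains \<alpha> \<beta> \<gamma> \<delta> \<epsilon> where "V = J3_hyperplane \<alpha> \<beta> \<gamma> \<delta> \<epsilon>" "(\<alpha>, \<beta>, \<gamma>, \<delta>, \<epsilon>) \<noteq> (0, 0, 0, 0, 0)"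
proof -
  have finV: "finite V" using sub card_J3(1) finite_subset by blast
  have cardV: "card V = 16"
  proof -
    have "card V = card (UNIV :: bit set) ^ 4"
      using card_mat_subspace[OF V finV] unfolding dim .
    moreover have "card (UNIV :: bit set) = 2" by (simp add: UNIV_bit)
    ultimately show ?thesis by simp
  qed
  note add = mat_subspace_add_closed[OF V]
  have carrier: "A \<in> carrier_mat 3 3" if "A \<in> J3" for A using that by (simp add: J3_def)
  have J3_add: "A + B \<in> J3" if "A \<in> J3" "B \<in> J3" for A B
    using that unfolding J3_eq mem_Collect_eq by (metis upper3_add)
  \<comment> \<open>The coset \<open>A + V\<close> is the whole complement of \<open>V\<close>, and it contains \<open>B\<close>.\<close>
  have index_2: "A + B \<in> V" if A: "A \<in> J3" "A \<notin> V" and B: "B \<in> J3" "B \<notin> V" for A B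
  proof -
    have "inj_on ((+) A) V"
      by (rule inj_on_inverseI[of _ "(+) A"]) (use A sub carrier mat_bit_add_self_left in blast)
    then have card: "card ((+) A ` V) = 16" using cardV by (simp add: card_image)
    have disj: "V \<inter> (+) A ` V = {}"
    proof (rule ccontr)
      assume "V \<inter> (+) A ` V \<noteq> {}"
      then obtain M where M: "M \<in> V" "A + M \<in> V" by blast
      then have "M + (M + A) \<in> V"
        using add comm_add_mat carrier A sub by (metis subsetD)
      then show False using mat_bit_add_self_left carrier A sub M by (metis subsetD)
    qed
    have "card (V \<union> (+) A ` V) = card J3"
      using card_Un_disjoint[OF finV _ disj] finV card cardV card_J3 by simp
    moreover have "V \<union> (+) A ` V \<subseteq> J3" using sub A J3_add by blast
    ultimately have "V \<union> (+) A ` V = J3" using card_J3(1) card_subset_eq by blast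
    then obtain M where "M \<in> V" "B = A + M" using B by blast
    then show ?thesis using mat_bit_add_self_left carrier A sub by (metis subsetD)
  qed
  define \<phi> :: "bit mat \<Rightarrow> bit" where "\<phi> A = (if A \<in> V then 0 else 1)" for A
  have \<phi>_add: "\<phi> (A + B) = \<phi> A + \<phi> B" if A: "A \<in> J3" and B: "B \<in> J3" for A B
  proof -
    note A' = carrier[OF A] and B' = carrier[OF B]
    have "B \<in> V" if "A \<in> V" "A + B \<in> V"
      using add[OF that] unfolding mat_bit_add_self_left[OF A' B'] .
    moreover have "A \<in> V" if "B \<in> V" "A + B \<in> V"
      using add[OF that] unfolding comm_add_mat[OF A' B'] mat_bit_add_self_left[OF B' A'] .
    ultimately have "A + B \<in> V \<longleftrightarrow> (A \<in> V \<longleftrightarrow> B \<in> V)"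
      using add index_2[OF A _ B] by blast
    then show ?thesis by (cases "A \<in> V"; cases "B \<in> V"; simp add: \<phi>_def)
  qed
  have zero: "upper3 0 0 0 0 0 = 0\<^sub>m 3 3"
    unfolding upper3_def by (rule mat_of_rows_list_3_eqI[symmetric]) auto
  have \<phi>_zero: "\<phi> (upper3 0 0 0 0 0) = 0"
    using mat_subspace_zero[OF V] by (simp add: \<phi>_def zero)
  define \<alpha> \<beta> \<gamma> \<delta> \<epsilon> where coeffs: "\<alpha> = \<phi> (upper3 1 0 0 0 0)" "\<beta> = \<phi> (upper3 0 1 0 0 0)"
    "\<gamma> = \<phi> (upper3 0 0 1 0 0)" "\<delta> = \<phi> (upper3 0 0 0 1 0)" "\<epsilon> = \<phi> (upper3 0 0 0 0 1)"
  have \<phi>_eq: "\<phi> (upper3 a b u v w) = \<alpha> * a + \<beta> * b + \<gamma> * u + \<delta> * v + \<epsilon> * w" for a b u v w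
  proof -
    have "upper3 a b u v w = upper3 a 0 0 0 0 + (upper3 0 b 0 0 0 + (upper3 0 0 u 0 0 +
        (upper3 0 0 0 v 0 + upper3 0 0 0 0 w)))"
      by (simp add: upper3_add)
    then have "\<phi> (upper3 a b u v w) = \<phi> (upper3 a 0 0 0 0) + (\<phi> (upper3 0 b 0 0 0) +
        (\<phi> (upper3 0 0 u 0 0) + (\<phi> (upper3 0 0 0 v 0) + \<phi> (upper3 0 0 0 0 w))))"
      by (simp only: \<phi>_add J3_add upper3_in_J3)
    also have "\<phi> (upper3 a 0 0 0 0) = \<alpha> * a"
      using \<phi>_zero by (cases a) (simp_all add: coeffs)
    also have "\<phi> (upper3 0 b 0 0 0) = \<beta> * b"
      using \<phi>_zero by (cases b) (simp_all add: coeffs)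
    also have "\<phi> (upper3 0 0 u 0 0) = \<gamma> * u"
      using \<phi>_zero by (cases u) (simp_all add: coeffs)
    also have "\<phi> (upper3 0 0 0 v 0) = \<delta> * v"
      using \<phi>_zero by (cases v) (simp_all add: coeffs)
    also have "\<phi> (upper3 0 0 0 0 w) = \<epsilon> * w"
      using \<phi>_zero by (cases w) (simp_all add: coeffs)
    finally show ?thesis by (simp only: add.assoc)
  qed
  have \<phi>_iff: "\<phi> A = 0 \<longleftrightarrow> A \<in> V" for A by (simp add: \<phi>_def)
  have "V = {A \<in> J3. \<phi> A = 0}" unfolding \<phi>_iff using sub by blast
  also have "\<dots> = J3_hyperplane \<alpha> \<beta> \<gamma> \<delta> \<epsilon>"
  proof (intro equalityI subsetI)
    fix A assume "A \<in> {A \<in> J3. \<phi> A = 0}"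
    then obtain a b u v w where "A = upper3 a b u v w" "\<phi> (upper3 a b u v w) = 0"
      unfolding J3_eq by blast
    then show "A \<in> J3_hyperplane \<alpha> \<beta> \<gamma> \<delta> \<epsilon>"
      unfolding J3_hyperplane_def \<phi>_eq by blast
  next
    fix A assume "A \<in> J3_hyperplane \<alpha> \<beta> \<gamma> \<delta> \<epsilon>"
    then obtain a b u v w where "A = upper3 a b u v w" "\<phi> (upper3 a b u v w) = 0"
      unfolding J3_hyperplane_def \<phi>_eq by blast
    then show "A \<in> {A \<in> J3. \<phi> A = 0}" by simp
  qed
  finally have V_eq: "V = J3_hyperplane \<alpha> \<beta> \<gamma> \<delta> \<epsilon>" .
  have "J3_hyperplane 0 0 0 0 0 = J3" by (simp add: J3_hyperplane_def J3_eq)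
  moreover have "V \<noteq> J3" using cardV card_J3 by force
  ultimately have "(\<alpha>, \<beta>, \<gamma>, \<delta>, \<epsilon>) \<noteq> (0, 0, 0, 0, 0)"
    using V_eq by (metis prod.inject)
  then show ?thesis using that V_eq by blast
qed

section \<open>Forms in the diagonal entries give non-primitive spaces\<close>

lemma (in vec_space) span_vec_index_zero:
  assumes "S \<subseteq> carrier_vec n" "i < n" "\<And>s. s \<in> S \<Longrightarrow> s $ i = 0" "v \<in> span S"
  shows "v $ i = 0"
proof -
  obtain c A where A: "finite A" "A \<subseteq> S" "v = lincomb c A"
    using assms(4) unfolding span_def by blast
  have "lincomb c A $ i = (\<Sum>x\<in>A. c x * x $ i)"
    using A assms(1,2) by (intro lincomb_index) auto
  also have "\<dots> = 0" using A assms(3) by (intro sum.neutral) auto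
  finally show ?thesis using A by simp
qed

text \<open>A unit vector lies in the kernel of every matrix of the space.\<close>
lemma not_primitive_col_zero:
  assumes zero: "\<And>M. M \<in> V \<Longrightarrow> M \<in> carrier_mat n p \<and> (\<forall>i<n. M $$ (i, j) = 0)" and j: "j < p"
  shows "\<not> primitive_space n p V"
proof
  assume prim: "primitive_space n p (V :: 'a::field mat set)"
  have "unit_vec p j \<in> mat_kernel M" if "M \<in> V" for M
  proof -
    have M: "M \<in> carrier_mat n p" "\<forall>i<n. M $$ (i, j) = 0" using zero that by auto
    have "M *\<^sub>v unit_vec p j = 0\<^sub>v n"
      by (rule eq_vecI) (use M j in auto)
    then show ?thesis using M by (intro mat_kernelI) auto
  qed
  then have "unit_vec p j = (0\<^sub>v p :: 'a vec)"
    using prim unfolding primitive_space_def by (meson unit_vec_carrier)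
  then show False using j by (metis index_unit_vec(1) index_zero_vec(1) zero_neq_one)
qed

text \<open>All ranges lie in a coordinate hyperplane, and so does their span.\<close>
lemma not_primitive_row_zero:
  assumes zero: "\<And>M. M \<in> V \<Longrightarrow> M \<in> carrier_mat n p \<and> (\<forall>j<p. M $$ (i, j) = 0)" and i: "i < n"
  shows "\<not> primitive_space n p V"
proof
  assume prim: "primitive_space n p (V :: 'a::field mat set)"
  interpret vec_space "TYPE('a)" n .
  let ?S = "\<Union>M \<in> V. {M *\<^sub>v x | x. x \<in> carrier_vec p}"
  have unit: "unit_vec n i \<in> span ?S"
    using prim unfolding primitive_space_def by (simp add: unit_vec_carrier)
  have sub: "?S \<subseteq> carrier_vec n" using zero by fastforce
  have "s $ i = 0" if s: "s \<in> ?S" for s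
  proof -
    obtain M x where M: "M \<in> V" "x \<in> carrier_vec p" "s = M *\<^sub>v x" using s by blast
    then show ?thesis using zero[OF M(1)] i by (auto simp: scalar_prod_def)
  qed
  from span_vec_index_zero[OF sub i this unit] show False using i by simp
qed

text \<open>The identity is the sum of this matrix and of a matrix of rank at most 1, and rank is
  subadditive.\<close>
lemma rank_diag_1_0_1: "2 \<le> vec_space.rank 3 (upper3 1 1 0 0 0)"
proof -
  define D :: "bit mat" where "D = mat_of_rows_list 3 [[0, 0, 0], [0, 1, 0], [0, 0, 0]]"
  interpret vec_space "TYPE(bit)" 3 .
  have D: "D \<in> carrier_mat 3 3" unfolding D_def by (rule mat_of_rows_list_3_carrier)
  have "upper3 1 1 0 0 0 + D = 1\<^sub>m 3"
    unfolding D_def upper3_def add_mat_of_rows_list_3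
    by (rule mat_of_rows_list_3_eqI[symmetric]) simp_all
  moreover have "rank (1\<^sub>m 3) = 3" by (rule low_rank_det_zero) simp_all
  ultimately have "3 \<le> rank (upper3 1 1 0 0 0) + rank D"
    using rank_subadditive[OF upper3_carrier D] by metis
  moreover have "rank D \<le> 1"
    by (rule rank_le_1_product_entries[OF D, of "\<lambda>i. if i = 1 then 1 else 0" "\<lambda>j. if j = 1 then 1 else 0"])
      (auto simp: D_def mat_of_rows_list_def numeral_3_eq_3 less_Suc_eq)
  ultimately show ?thesis by simp
qed

lemma mat_equivalent_refl:
  assumes "V \<subseteq> carrier_mat n p"
  shows "mat_equivalent n p V V"
proof -
  have one: "invertible_mat (1\<^sub>m k :: 'a::field mat)" for k
    unfolding invertible_mat_def inverts_mat_def by (auto intro!: exI[of _ "1\<^sub>m k"])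
  have "1\<^sub>m n * M * 1\<^sub>m p = M" if "M \<in> V" for M
    using assms that by (auto simp: subset_iff)
  then have "V = (\<lambda>M. 1\<^sub>m n * M * 1\<^sub>m p) ` V" by simp
  then show ?thesis
    unfolding mat_equivalent_def using one one_carrier_mat by metis
qed

text \<open>Equal first and last diagonal entries force the middle one to vanish. The first two
  columns are then supported on the first row, so deleting the last column leaves matrices of rank at
  most 1, whereas the space contains a matrix of rank 2. This violates the third condition of
  primitivity, with the space itself as the equivalent space.\<close>
lemma not_primitive_equal_diagonal_ends:
  "\<not> primitive_space 3 3 {upper3 a a u v w | a u v w. True}" (is "\<not> primitive_space 3 3 ?V")
proof
  assume prim: "primitive_space 3 3 ?V"
  have "finite ?V" using card_J3(1) by (rule finite_subset[rotated]) auto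
  have "?V \<noteq> {}" by blast
  have "vec_space.rank 3 (upper3 1 1 0 0 0) \<le> upper_rank 3 ?V"
    unfolding upper_rank_def using \<open>finite ?V\<close> by (intro Max_ge finite_imageI imageI) blast+
  then have ge: "2 \<le> upper_rank 3 ?V" using rank_diag_1_0_1 by simp
  define H :: "bit mat \<Rightarrow> bit mat" where "H M = mat 3 2 (\<lambda>(i, j). M $$ (i, j))" for M
  have carrier: "H M \<in> carrier_mat 3 2" for M by (simp add: H_def)
  have "vec_space.rank 3 (H M) \<le> 1" if MV: "M \<in> ?V" for M
  proof (rule vec_space.rank_le_1_product_entries[OF carrier])
    obtain a u v w where M: "M = upper3 a a u v w" using MV by blast
    fix i j assume "i < dim_row (H M)" "j < dim_col (H M)"
    then show "H M $$ (i, j) = (if i = 0 then 1 else 0) * M $$ (0, j)"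
      by (auto simp: H_def M upper3_def mat_of_rows_list_def numeral_3_eq_3 numeral_2_eq_2 less_Suc_eq bit_add_self)
  qed
  then have "upper_rank 3 (H ` ?V) \<le> 1"
    unfolding upper_rank_def using \<open>finite ?V\<close> \<open>?V \<noteq> {}\<close> by (subst Max_le_iff) auto
  then have "int (upper_rank 3 (H ` ?V)) \<le> int (upper_rank 3 ?V) - 1" using ge by linarith
  moreover have "mat_equivalent 3 3 ?V ?V" by (rule mat_equivalent_refl) auto
  moreover have "\<forall>M\<in>?V. H M \<in> carrier_mat 3 (3 - 1) \<and> (\<exists>C\<in>carrier_mat 3 1. M = H M @\<^sub>c C)"
  proof
    fix M assume "M \<in> ?V"
    then have M: "M \<in> carrier_mat 3 3" using upper3_carrier by blast
    let ?C = "mat 3 1 (\<lambda>(i, j). M $$ (i, 2))"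
    have "M = H M @\<^sub>c ?C"
      by (rule eq_matI) (use M in \<open>auto simp: H_def append_cols_def numeral_3_eq_3 numeral_2_eq_2 less_Suc_eq\<close>)
    then show "H M \<in> carrier_mat 3 (3 - 1) \<and> (\<exists>C\<in>carrier_mat 3 1. M = H M @\<^sub>c C)"
      using carrier[of M] by (auto intro: bexI[of _ ?C])
  qed
  ultimately show False using prim unfolding primitive_space_def by blast
qed

text \<open>The three possible forms are \<open>a\<close>, whose zero set has first column zero, \<open>b\<close>, whose
  zero set has last row zero, and \<open>a + b\<close>.\<close>
lemma not_primitive_diagonal_form:
  assumes "(\<alpha>, \<beta>) \<noteq> (0, 0)"
  shows "\<not> primitive_space 3 3 (J3_hyperplane \<alpha> \<beta> 0 0 0)"
proof -
  have eq: "a + b = 0 \<longleftrightarrow> b = a" for a b :: bit by (cases a; cases b) simp_all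
  consider "\<alpha> = 1" "\<beta> = 0" | "\<alpha> = 0" "\<beta> = 1" | "\<alpha> = 1" "\<beta> = 1"
    using assms by (cases \<alpha>; cases \<beta>) auto
  then show ?thesis
  proof cases
    case 1
    have "M \<in> carrier_mat 3 3 \<and> (\<forall>i<3. M $$ (i, 0) = 0)" if "M \<in> J3_hyperplane \<alpha> \<beta> 0 0 0" for M
      using that upper3_carrier unfolding J3_hyperplane_def 1 less_3_cases by (auto simp: upper3_index[unfolded One_nat_def])
    from not_primitive_col_zero[OF this] show ?thesis by simp
  next
    case 2
    have "M \<in> carrier_mat 3 3 \<and> (\<forall>j<3. M $$ (2, j) = 0)" if "M \<in> J3_hyperplane \<alpha> \<beta> 0 0 0" for M
      using that upper3_carrier unfolding J3_hyperplane_def 2 less_3_cases by (auto simp: upper3_index[unfolded One_nat_def])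
    from not_primitive_row_zero[OF this] show ?thesis by simp
  next
    case 3
    have "J3_hyperplane \<alpha> \<beta> 0 0 0 = {upper3 a a u v w | a u v w. True}"
      unfolding J3_hyperplane_def 3 mult_1 mult_zero_left add_0_right eq by blast
    then show ?thesis using not_primitive_equal_diagonal_ends by simp
  qed
qed

section \<open>Reduction of the remaining hyperplanes\<close>

lemma N_eq_J3_hyperplane:
  "N1 = J3_hyperplane 0 0 0 1 0" "N2 = J3_hyperplane 0 0 0 0 1"
  "N3 = J3_hyperplane 0 0 1 0 0" "N4 = J3_hyperplane 0 0 1 0 1"
proof -
  have eq: "x + y = 0 \<longleftrightarrow> y = x" for x y :: bit by (cases x; cases y) simp_all
  show "N1 = J3_hyperplane 0 0 0 1 0" "N2 = J3_hyperplane 0 0 0 0 1"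
  "N3 = J3_hyperplane 0 0 1 0 0" "N4 = J3_hyperplane 0 0 1 0 1"
  unfolding N1_def N2_def N3_def N4_def J3_hyperplane_def upper3_def
  by (auto simp: eq simp del: add_bit_eq_xor mult_bit_eq_and)
qed

definition unitri3 :: "bit \<Rightarrow> bit \<Rightarrow> bit \<Rightarrow> bit mat" where
  "unitri3 p q m = mat_of_rows_list 3 [[1, p, q], [0, 1, m], [0, 0, 1]]"

lemma unitri3_carrier [simp]: "unitri3 p q m \<in> carrier_mat 3 3"
  unfolding unitri3_def by (rule mat_of_rows_list_3_carrier)

lemma unitri3_mult_upper3_mult_unitri3:
  "unitri3 p q m * upper3 a b u v w * unitri3 r s t =
     upper3 a b (u + r * a + p * (a + b))
       (v + p * w + q * b + s * a + t * u + t * p * (a + b)) (w + t * (a + b) + m * b)"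
  unfolding unitri3_def upper3_def mult_mat_of_rows_list_3
  by (simp add: algebra_simps del: add_bit_eq_xor mult_bit_eq_and)

lemma unitri3_invertible: "invertible_mat (unitri3 p q m)"
proof -
  have inverse: "unitri3 p q m * unitri3 p (q + p * m) m = 1\<^sub>m 3" for p q m
    unfolding unitri3_def mult_mat_of_rows_list_3
    by (rule mat_of_rows_list_3_eqI[symmetric]) (simp_all, (cases p; cases q; cases m; simp)+)
  have "q + p * m + p * m = q" by (cases "p * m"; cases q) simp_all
  then have "unitri3 p (q + p * m) m * unitri3 p q m = 1\<^sub>m 3"
    using inverse[of p "q + p * m" m] by simp
  then show ?thesis
    unfolding invertible_mat_def inverts_mat_def square_mat.simps carrier_matD[OF unitri3_carrier]
    using inverse[of p q m] carrier_matD[OF unitri3_carrier] by metis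
qed

text \<open>Multiplication by unitriangular matrices on both sides permutes the finite set \<^const>\<open>J3\<close>, so
  it carries the zero set of a form pulled back along it onto the zero set of the form. The
  coefficients on the left are those of the pulled-back form.\<close>
lemma J3_hyperplane_equivalent:
  "mat_equivalent 3 3
     (J3_hyperplane (\<alpha> + \<gamma> * (r + p) + \<delta> * (s + t * p) + \<epsilon> * t)
        (\<beta> + \<gamma> * p + \<delta> * (q + t * p) + \<epsilon> * (t + m)) (\<gamma> + \<delta> * t) \<delta> (\<epsilon> + \<delta> * p))
     (J3_hyperplane \<alpha> \<beta> \<gamma> \<delta> \<epsilon>)" (is "mat_equivalent 3 3 ?V ?W")
proof -
  define f where "f M = unitri3 p q m * M * unitri3 r s t" for M
  have f: "f (upper3 a b u v w) = upper3 a b (u + r * a + p * (a + b))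
       (v + p * w + q * b + s * a + t * u + t * p * (a + b)) (w + t * (a + b) + m * b)" for a b u v w
    by (simp only: f_def unitri3_mult_upper3_mult_unitri3)
  have "f ` J3 \<subseteq> J3" unfolding J3_eq using f by blast
  moreover have "inj_on f J3"
    unfolding J3_eq inj_on_def
    by (auto simp: f upper3_inject simp del: add_bit_eq_xor mult_bit_eq_and)
  ultimately have surj: "f ` J3 = J3" using endo_inj_surj card_J3(1) by blast
  have form: "f (upper3 a b u v w) \<in> ?W \<longleftrightarrow> upper3 a b u v w \<in> ?V" for a b u v w
  proof -
    have mem: "upper3 a b u v w \<in> J3_hyperplane \<alpha> \<beta> \<gamma> \<delta> \<epsilon> \<longleftrightarrow>
        \<alpha> * a + \<beta> * b + \<gamma> * u + \<delta> * v + \<epsilon> * w = 0" for a b u v w \<alpha> \<beta> \<gamma> \<delta> \<epsilon>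
      unfolding J3_hyperplane_def mem_Collect_eq upper3_inject by blast
    show ?thesis unfolding f mem
      by (simp only: distrib_left distrib_right mult.assoc mult.commute mult.left_commute add.assoc add.commute add.left_commute)
  qed
  have sub: "J3_hyperplane \<alpha> \<beta> \<gamma> \<delta> \<epsilon> \<subseteq> J3" for \<alpha> \<beta> \<gamma> \<delta> \<epsilon>
    unfolding J3_hyperplane_def using upper3_in_J3 by blast
  have iff: "f B \<in> ?W \<longleftrightarrow> B \<in> ?V" if B: "B \<in> J3" for B
  proof -
    obtain a b u v w where "B = upper3 a b u v w" using B unfolding J3_eq by blast
    then show ?thesis by (simp only: form)
  qed
  have "?W = f ` ?V"
  proof (intro equalityI subsetI)
    fix A assume A: "A \<in> ?W"
    then have "A \<in> f ` J3" unfolding surj using sub by (rule rev_subsetD)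
    then obtain B where "B \<in> J3" "A = f B" by blast
    then show "A \<in> f ` ?V" using A iff by blast
  next
    fix A assume "A \<in> f ` ?V"
    then obtain B where "B \<in> ?V" "A = f B" by blast
    then show "A \<in> ?W" using iff subsetD[OF sub] by blast
  qed
  then show ?thesis
    unfolding mat_equivalent_def f_def
    using unitri3_carrier unitri3_invertible by blast
qed

text \<open>A non-zero coefficient of the corner entry absorbs all the others: a row operation and a column
  operation remove the coefficients of the two superdiagonal entries, and two further operations, which
  add multiples of \<open>a\<close> and \<open>b\<close> to the corner, remove those of the diagonal entries. If the corner
  does not occur, the set of superdiagonal entries that occur does not change, and adding multiples
  of the diagonal entries to them clears the diagonal part of the form.\<close>
lemma J3_hyperplane_equivalent_N:
  assumes "(\<gamma>, \<delta>, \<epsilon>) \<noteq> (0, 0, 0)"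
  shows "\<exists>N \<in> {N1, N2, N3, N4}. mat_equivalent 3 3 (J3_hyperplane \<alpha> \<beta> \<gamma> \<delta> \<epsilon>) N"
proof -
  note [simp del] = add_bit_eq_xor mult_bit_eq_and
  consider "\<delta> = 1" | "\<gamma> = 1" "\<delta> = 0" "\<epsilon> = 0" | "\<gamma> = 0" "\<delta> = 0" "\<epsilon> = 1" | "\<gamma> = 1" "\<delta> = 0" "\<epsilon> = 1"
    using assms by (cases \<gamma>; cases \<delta>; cases \<epsilon>) auto
  \<comment> \<open>The first five values are the target form. The others solve the equations that say that
    its pull-back is the given form.\<close>
  then show ?thesis
  proof cases
    case 1
    then show ?thesis
      using J3_hyperplane_equivalent[where \<alpha> = 0 and \<beta> = 0 and \<gamma> = 0 and \<delta> = 1 and \<epsilon> = 0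
          and p = \<epsilon> and q = "\<beta> + \<gamma> * \<epsilon>" and m = 0 and r = 0 and s = "\<alpha> + \<gamma> * \<epsilon>" and t = \<gamma>]
      by (simp add: N_eq_J3_hyperplane add.assoc bit_add_self)
  next
    case 2
    then show ?thesis
      using J3_hyperplane_equivalent[where \<alpha> = 0 and \<beta> = 0 and \<gamma> = 1 and \<delta> = 0 and \<epsilon> = 0
          and p = \<beta> and q = 0 and m = 0 and r = "\<alpha> + \<beta>" and s = 0 and t = 0]
      by (simp add: N_eq_J3_hyperplane add.assoc bit_add_self)
  next
    case 3
    then show ?thesis
      using J3_hyperplane_equivalent[where \<alpha> = 0 and \<beta> = 0 and \<gamma> = 0 and \<delta> = 0 and \<epsilon> = 1
          and p = 0 and q = 0 and m = "\<alpha> + \<beta>" and r = 0 and s = 0 and t = \<alpha>]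
      by (simp add: N_eq_J3_hyperplane add.assoc[symmetric] bit_add_self)
  next
    case 4
    then show ?thesis
      using J3_hyperplane_equivalent[where \<alpha> = 0 and \<beta> = 0 and \<gamma> = 1 and \<delta> = 0 and \<epsilon> = 1
          and p = 0 and q = 0 and m = \<beta> and r = \<alpha> and s = 0 and t = 0]
      by (simp add: N_eq_J3_hyperplane)
  qed
qed

section \<open>An invariant that separates the four spaces\<close>

text \<open>The multiset of the dimensions of the spaces \<open>{M x | M \<in> V}\<close> is invariant under equivalence.
  Over a finite field, adding up the sizes of these spaces condenses it to a single number.\<close>
definition evaluation_total :: "nat \<Rightarrow> 'a::field mat set \<Rightarrow> nat" where
  "evaluation_total p V = (\<Sum>x\<in>carrier_vec p. card ((\<lambda>M. M *\<^sub>v x) ` V))"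

text \<open>Replacing \<open>V\<close> by \<open>P V Q\<close> turns \<open>V x\<close> into \<open>P (V (Q x))\<close>. The factor \<open>P\<close> preserves the size
  because it is injective, and \<open>Q\<close> only permutes the terms of the sum.\<close>
lemma evaluation_total_equivalent:
  assumes "mat_equivalent n p V W" and V: "V \<subseteq> carrier_mat n p"
  shows "evaluation_total p W = evaluation_total p V"
proof -
  obtain P Q where PQ: "P \<in> carrier_mat n n" "Q \<in> carrier_mat p p" "invertible_mat P" "invertible_mat Q"
    and W: "W = (\<lambda>M. P * M * Q) ` V"
    using assms(1) unfolding mat_equivalent_def by blast
  have inverse: "\<exists>B. B \<in> carrier_mat k k \<and> B * A = 1\<^sub>m k \<and> A * B = 1\<^sub>m k"
    if A: "A \<in> carrier_mat k k" "invertible_mat A" for A :: "'a mat" and k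
  proof -
    obtain B where B: "A * B = 1\<^sub>m (dim_row A)" "B * A = 1\<^sub>m (dim_row B)"
      using A(2) unfolding invertible_mat_def inverts_mat_def by blast
    have "dim_col (A * B) = k" "dim_col (B * A) = dim_row B" using A B by auto
    then have "B \<in> carrier_mat k k" using A by (intro carrier_matI) auto
    then show ?thesis using A B by auto
  qed
  obtain P' where P': "P' \<in> carrier_mat n n" "P' * P = 1\<^sub>m n" using inverse PQ by blast
  obtain Q' where Q': "Q' \<in> carrier_mat p p" "Q' * Q = 1\<^sub>m p" "Q * Q' = 1\<^sub>m p" using inverse PQ by blast
  have "card ((\<lambda>M. M *\<^sub>v x) ` W) = card ((\<lambda>M. M *\<^sub>v (Q *\<^sub>v x)) ` V)" if x: "x \<in> carrier_vec p" for x
  proof -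
    have "inj_on (\<lambda>y. P *\<^sub>v y) (carrier_vec n)"
      by (rule inj_on_inverseI[of _ "\<lambda>y. P' *\<^sub>v y"])
        (use PQ P' in \<open>simp add: assoc_mult_mat_vec[symmetric]\<close>)
    moreover have "(\<lambda>M. M *\<^sub>v (Q *\<^sub>v x)) ` V \<subseteq> carrier_vec n"
      using V PQ x by auto
    ultimately have "card ((\<lambda>y. P *\<^sub>v y) ` (\<lambda>M. M *\<^sub>v (Q *\<^sub>v x)) ` V) = card ((\<lambda>M. M *\<^sub>v (Q *\<^sub>v x)) ` V)"
      using card_image inj_on_subset by blast
    moreover have "(P * M * Q) *\<^sub>v x = P *\<^sub>v (M *\<^sub>v (Q *\<^sub>v x))" if "M \<in> V" for M
    proof -
      have M: "M \<in> carrier_mat n p" using that V by blast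
      have "(P * M * Q) *\<^sub>v x = (P * M) *\<^sub>v (Q *\<^sub>v x)"
        using PQ M x by (intro assoc_mult_mat_vec) auto
      also have "\<dots> = P *\<^sub>v (M *\<^sub>v (Q *\<^sub>v x))"
        using PQ M x by (intro assoc_mult_mat_vec) auto
      finally show ?thesis .
    qed
    ultimately show ?thesis unfolding W image_image by (simp cong: image_cong)
  qed
  moreover have "bij_betw (\<lambda>x. Q *\<^sub>v x) (carrier_vec p) (carrier_vec p)"
    by (rule bij_betw_byWitness[of _ "\<lambda>x. Q' *\<^sub>v x"])
      (use PQ Q' in \<open>auto simp: assoc_mult_mat_vec[symmetric]\<close>)
  ultimately show ?thesis
    unfolding evaluation_total_def
    using sum.reindex_bij_betw[of "\<lambda>x. Q *\<^sub>v x" "carrier_vec p" "carrier_vec p" "\<lambda>x. card ((\<lambda>M. M *\<^sub>v x) ` V)"]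
    by simp
qed

lemma upper3_mult_vec: "upper3 a b u v w *\<^sub>v vec_of_list [x, y, z] =
    vec_of_list [a * x + u * y + v * z, (a + b) * y + w * z, b * z]"
  unfolding upper3_def mult_mat_of_rows_list_3_vec
  by (simp del: add_bit_eq_xor mult_bit_eq_and)

lemma evaluation_total_upper3:
  "evaluation_total 3 ((\<lambda>(a, b, u, v, w). upper3 a b u v w) ` S) =
    (\<Sum>x\<in>UNIV. \<Sum>y\<in>UNIV. \<Sum>z\<in>UNIV.
       card ((\<lambda>(a, b, u, v, w). (a * x + u * y + v * z, (a + b) * y + w * z, b * z)) ` S))"
proof -
  define vec3 :: "bit \<times> bit \<times> bit \<Rightarrow> bit vec" where "vec3 = (\<lambda>(x, y, z). vec_of_list [x, y, z])"
  have inj: "inj vec3"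
  proof (rule injI)
    fix s t assume eq: "vec3 s = vec3 t"
    obtain x y z x' y' z' where st: "s = (x, y, z)" "t = (x', y', z')" by (metis prod_cases3)
    have "list_of_vec (vec3 s) = list_of_vec (vec3 t)" by (simp only: eq)
    then show "s = t" by (simp add: vec3_def st list_vec)
  qed
  have carrier: "carrier_vec 3 = range vec3"
  proof (intro equalityI subsetI)
    fix v :: "bit vec" assume "v \<in> carrier_vec 3"
    then obtain x y z where "v = vec3 (x, y, z)"
      unfolding carrier_vec_3_eq vec3_def by auto
    then show "v \<in> range vec3" by blast
  qed (auto simp: vec3_def carrier_vec_3_eq)
  have "evaluation_total 3 ((\<lambda>(a, b, u, v, w). upper3 a b u v w) ` S) =
      (\<Sum>t\<in>UNIV. card ((\<lambda>M. M *\<^sub>v vec3 t) ` (\<lambda>(a, b, u, v, w). upper3 a b u v w) ` S))"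
    unfolding evaluation_total_def carrier by (rule sum.reindex_cong[OF inj refl refl])
  also have "\<dots> = (\<Sum>(x, y, z)\<in>UNIV.
       card ((\<lambda>(a, b, u, v, w). (a * x + u * y + v * z, (a + b) * y + w * z, b * z)) ` S))"
  proof (rule sum.cong[OF refl], clarify)
    fix x y z :: bit
    have "(\<lambda>M. M *\<^sub>v vec3 (x, y, z)) ` (\<lambda>(a, b, u, v, w). upper3 a b u v w) ` S =
      vec3 ` (\<lambda>(a, b, u, v, w). (a * x + u * y + v * z, (a + b) * y + w * z, b * z)) ` S"
      unfolding image_image vec3_def
      by (rule image_cong[OF refl]) (simp only: split_paired_all prod.case upper3_mult_vec)
    then show "card ((\<lambda>M. M *\<^sub>v vec3 (x, y, z)) ` (\<lambda>(a, b, u, v, w). upper3 a b u v w) ` S) =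
      card ((\<lambda>(a, b, u, v, w). (a * x + u * y + v * z, (a + b) * y + w * z, b * z)) ` S)"
      by (simp only: card_image[OF inj_on_subset[OF inj subset_UNIV]])
  qed
  also have "\<dots> = (\<Sum>x\<in>UNIV. \<Sum>y\<in>UNIV. \<Sum>z\<in>UNIV.
       card ((\<lambda>(a, b, u, v, w). (a * x + u * y + v * z, (a + b) * y + w * z, b * z)) ` S))"
    unfolding UNIV_Times_UNIV[symmetric] by (simp only: sum.cartesian_product)
  finally show ?thesis .
qed

text \<open>The sums and cardinalities are written with lists so that the simplifier can evaluate them.\<close>
lemma evaluation_total_upper3_family:
  fixes u v w :: "bit \<Rightarrow> bit \<Rightarrow> bit"
  shows "evaluation_total 3 {upper3 a b (u c d) (v c d) (w c d) | a b c d. True} =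
    (\<Sum>x\<leftarrow>[0, 1]. \<Sum>y\<leftarrow>[0, 1]. \<Sum>z\<leftarrow>[0, 1]. length (remdups
       [(a * x + u c d * y + v c d * z, (a + b) * y + w c d * z, b * z).
          a \<leftarrow> [0, 1], b \<leftarrow> [0, 1], c \<leftarrow> [0, 1], d \<leftarrow> [0, 1]]))"
proof -
  let ?S = "\<Union>a. \<Union>b. \<Union>c. \<Union>d. {(a, b, u c d, v c d, w c d)}"
  have eq: "{upper3 a b (u c d) (v c d) (w c d) | a b c d. True} = (\<lambda>(a, b, u, v, w). upper3 a b u v w) ` ?S"
    unfolding image_UN image_insert image_empty prod.case by blast
  have sum: "(\<Sum>x\<in>UNIV. f x) = (\<Sum>x\<leftarrow>[0, 1]. f x)" for f :: "bit \<Rightarrow> nat"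
    by (simp add: UNIV_bit)
  have set: "(\<lambda>(a, b, u, v, w). (a * x + u * y + v * z, (a + b) * y + w * z, b * z)) ` ?S =
      set [(a * x + u c d * y + v c d * z, (a + b) * y + w c d * z, b * z).
        a \<leftarrow> [0, 1], b \<leftarrow> [0, 1], c \<leftarrow> [0, 1], d \<leftarrow> [0, 1]]" for x y z
  proof -
    have bits: "UNIV = set [0, 1 :: bit]" by (simp add: UNIV_bit)
    show ?thesis
      unfolding image_UN image_insert image_empty prod.case UNION_singleton_eq_range
      unfolding bits by (simp only: set_concat set_map image_image prod.case)
  qed
  show ?thesis
    unfolding eq evaluation_total_upper3 set length_remdups_card_conv sum ..
qed

text \<open>The eight spaces \<open>V x\<close> have the sizes 1, 2, 4, 4, 4, 8, 8, 8 for \<^const>\<open>N1\<close>,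
  1, 2, 4, 4, 4, 4, 8, 8 for \<^const>\<open>N2\<close>, 1, 2, 2, 4, 8, 8, 8, 8 for \<^const>\<open>N3\<close> and
  1, 2, 4, 4, 8, 8, 8, 8 for \<^const>\<open>N4\<close>.\<close>
lemma evaluation_total_N:
  "evaluation_total 3 N1 = 39" "evaluation_total 3 N2 = 35"
  "evaluation_total 3 N3 = 41" "evaluation_total 3 N4 = 43"
proof -
  have N1: "N1 = {upper3 a b c 0 d | a b c d. True}" by (simp only: N1_def upper3_def)
  show "evaluation_total 3 N1 = 39"
    unfolding N1 evaluation_total_upper3_family by simp
  have N2: "N2 = {upper3 a b c d 0 | a b c d. True}" by (simp only: N2_def upper3_def)
  show "evaluation_total 3 N2 = 35"
    unfolding N2 evaluation_total_upper3_family by simp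
  have N3: "N3 = {upper3 a b 0 c d | a b c d. True}" by (simp only: N3_def upper3_def)
  show "evaluation_total 3 N3 = 41"
    unfolding N3 evaluation_total_upper3_family by simp
  have N4: "N4 = {upper3 a b c d c | a b c d. True}" by (simp only: N4_def upper3_def)
  show "evaluation_total 3 N4 = 43"
    unfolding N4 evaluation_total_upper3_family by simp
qed

section \<open>Classification\<close>

theorem proposition4p3:
  fixes V :: "bit mat set"
  assumes "primitive_space 3 3 V"
    and "V \<subseteq> J3"
    and "mat_subspace_dim 3 3 V = 4"
  shows "\<exists>!i. i < 4 \<and> mat_equivalent 3 3 V ([N1, N2, N3, N4] ! i)"
proof -
  have "mat_subspace 3 3 V" using assms(1) by (simp add: primitive_space_def)
  then obtain \<alpha> \<beta> \<gamma> \<delta> \<epsilon> where V: "V = J3_hyperplane \<alpha> \<beta> \<gamma> \<delta> \<epsilon>"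
    and nonzero: "(\<alpha>, \<beta>, \<gamma>, \<delta>, \<epsilon>) \<noteq> (0, 0, 0, 0, 0)"
    using dim_4_subspace_is_J3_hyperplane assms(2,3) by metis
  have "(\<gamma>, \<delta>, \<epsilon>) \<noteq> (0, 0, 0)"
    using not_primitive_diagonal_form[of \<alpha> \<beta>] assms(1) nonzero unfolding V by fastforce
  then obtain N where "N \<in> {N1, N2, N3, N4}" "mat_equivalent 3 3 V N"
    using J3_hyperplane_equivalent_N V by metis
  moreover have "{N1, N2, N3, N4} = set [N1, N2, N3, N4]" by simp
  ultimately have "\<exists>i < length [N1, N2, N3, N4]. mat_equivalent 3 3 V ([N1, N2, N3, N4] ! i)"
    by (metis in_set_conv_nth)
  moreover have "length [N1, N2, N3, N4] = 4" by simp
  ultimately obtain i where i: "i < 4" "mat_equivalent 3 3 V ([N1, N2, N3, N4] ! i)" by metis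
  have total: "[39, 35, 41, 43] ! j = evaluation_total 3 V"
    if "j < 4" "mat_equivalent 3 3 V ([N1, N2, N3, N4] ! j)" for j
  proof -
    have "V \<subseteq> carrier_mat 3 3" using assms(2) by (auto simp: J3_def)
    then have "evaluation_total 3 ([N1, N2, N3, N4] ! j) = evaluation_total 3 V"
      using evaluation_total_equivalent that(2) by blast
    moreover have "evaluation_total 3 ([N1, N2, N3, N4] ! j) =
        map (evaluation_total 3) [N1, N2, N3, N4] ! j"
      using that(1) by (intro nth_map[symmetric]) simp
    ultimately show ?thesis by (simp only: list.map evaluation_total_N)
  qed
  have "distinct [39, 35, 41, 43 :: nat]" "length [39, 35, 41, 43 :: nat] = 4" by simp_all
  then have "j = i" if "j < 4" "mat_equivalent 3 3 V ([N1, N2, N3, N4] ! j)" for j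
    using total[OF that] total[OF i] that(1) i(1) nth_eq_iff_index_eq by metis
  then show ?thesis using i by blast
qed

end
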